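(* Let $\mathbf{k}$ be a field and let $\sigma\subseteq N_{\mathbb{R}}$ be a nonzero strongly convex rational cone. Every non-trivial $\mathbb{G}_{\mathrm a}$-action on the affine toric variety $X_\sigma=\operatorname{Spec}\mathbf{k}[\sigma^\vee_M]$ which is normalized by the $\mathbb{T}$-action is given by a homogeneous LFIHD of the form $\lambda\partial_e=\{\lambda^i\partial_e^{(i)}\}_{i\ge 0}$, where $e\in\operatorname{Rt}\sigma$ is a Demazure root of $\sigma$ and $\lambda\in\mathbf{k}^*$.
   Context: $\mathbb{T}\simeq\mathbb{G}_{\mathrm m}^n$ is a split torus over $\mathbf{k}$, $M$ its character lattice, $N$ its lattice of one-parameter subgroups, $M_{\mathbb{R}}=M\otimes\mathbb{R}$, $N_{\mathbb{R}}=N\otimes\mathbb{R}$, with duality pairing $\langle m,v\rangle$. A rational cone in $N_{\mathbb R}$ is a cone generated by a finite subset of $N$; it is strongly convex if $0$ is a face. $\sigma^\vee\subseteq M_{\mathbb{R}}$ is the dual cone, $\sigma^\vee_M=\sigma^\vee\cap M$, and $\mathbf{k}[\sigma^\vee_M]=\bigoplus_{m\in\sigma^\vee_M}\mathbf{k}\chi^m$ is the semigroup algebra ($\chi^m\chi^{m'}=\chi^{m+m'}$, $\chi^0=1$). $\sigma(1)$ is the set of extremal rays, each identified with its primitive vector in $N$. A vector $e\in M$ is a Demazure root of $\sigma$ ($e\in\operatorname{Rt}\sigma$) if there is $\rho\in\sigma(1)$ with $\langle e,\rho\rangle=-1$ and $\langle e,\rho'\rangle\ge 0$ for all $\rho'\in\sigma(1)\setminus\{\rho\}$;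 $\rho$ is called the distinguished ray of $e$. A locally finite iterative higher derivation (LFIHD) on a $\mathbf{k}$-algebra $A$ is a sequence $\partial=\{\partial^{(i)}\}_{i\in\mathbb{Z}_{\ge0}}$ of $\mathbf{k}$-linear operators on $A$ such that: $\partial^{(0)}=\mathrm{id}$; $\partial^{(i)}(fg)=\sum_{j=0}^i\partial^{(j)}(f)\partial^{(i-j)}(g)$; for every $f\in A$ one has $\partial^{(i)}(f)=0$ for all large $i$; and $\partial^{(i)}\circ\partial^{(j)}=\binom{i+j}{i}\partial^{(i+j)}$. LFIHDs on $A$ correspond to $\mathbb{G}_{\mathrm a}$-actions on $\operatorname{Spec}A$ via the comorphism $e^{x\partial}=\sum_i\partial^{(i)}x^i:A\to A[x]$. It is non-trivial if $\ker\partial=\{f:\partial^{(i)}(f)=0\ \forall i>0\}\ne A$. On $A=\mathbf{k}[\sigma^\vee_M]$, $\partial$ is homogeneous of degree $e\in M$ if $\partial^{(i)}$ sends each homogeneous piece of degree $m$ into the piece of degree $m+ie$ for all $i\ge 0$ and all $m$. A $\mathbb{G}_{\mathrm a}$-action is normalized by the $\mathbb{T}$-action if the corresponding LFIHD is homogeneous. For $e\in\operatorname{Rt}\sigma$ with distinguished ray $\rho$, $\partial_e$ is the homogeneous LFIHD on $\mathbf{k}[\sigma^\vee_M]$ given by $\partial_e^{(i)}(\chi^m)=\binom{\langle m,\rho\rangle}{i}\chi^{m+ie}$ for all $i\ge0$, $m\in\sigma^\vee_M$, with the convention $\binom{r_1}{r_2}=0$ for $0\le r_1<r_2$. *)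

theory Defs
  imports
    "HOL-Analysis.Analysis"
    "HOL-Library.Poly_Mapping"
    "HOL-Computational_Algebra.Polynomial"
begin

section \<open>Higher derivations and additive group actions\<close>

text \<open>
  A \<open>k\<close>-algebra is a subset \<open>A\<close> of an ambient commutative ring that contains the image of a
  structure map \<open>\<iota> : k \<rightarrow> A\<close>; the scalar multiple \<open>c \<cdot> f\<close> is \<open>\<iota> c * f\<close>. Operators are only
  constrained on \<open>A\<close>; their values off \<open>A\<close> are irrelevant.
\<close>

definition subalgebra :: "('k::field \<Rightarrow> 'a::comm_ring_1) \<Rightarrow> 'a set \<Rightarrow> bool" where
  "subalgebra \<iota> A \<longleftrightarrow> 1 \<in> A \<and> range \<iota> \<subseteq> A \<and>
     (\<forall>f\<in>A. \<forall>g\<in>A. f + g \<in> A \<and> f - g \<in> A \<and> f * g \<in> A)"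

definition lfihd :: "('k::field \<Rightarrow> 'a::comm_ring_1) \<Rightarrow> 'a set \<Rightarrow> (nat \<Rightarrow> 'a \<Rightarrow> 'a) \<Rightarrow> bool" where
  "lfihd \<iota> A D \<longleftrightarrow>
     (\<forall>i. \<forall>f\<in>A. D i f \<in> A) \<and>
     (\<forall>i. \<forall>f\<in>A. \<forall>g\<in>A. D i (f + g) = D i f + D i g) \<and>
     (\<forall>i c. \<forall>f\<in>A. D i (\<iota> c * f) = \<iota> c * D i f) \<and>
     (\<forall>f\<in>A. D 0 f = f) \<and>
     (\<forall>i. \<forall>f\<in>A. \<forall>g\<in>A. D i (f * g) = (\<Sum>j\<le>i. D j f * D (i - j) g)) \<and>
     (\<forall>f\<in>A. \<exists>n. \<forall>i\<ge>n. D i f = 0) \<and>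
     (\<forall>i j. \<forall>f\<in>A. D i (D j f) = of_nat ((i + j) choose i) * D (i + j) f)"

definition lfihd_kernel :: "'a set \<Rightarrow> (nat \<Rightarrow> 'a \<Rightarrow> 'a::zero) \<Rightarrow> 'a set" where
  "lfihd_kernel A D = {f \<in> A. \<forall>i>0. D i f = 0}"

definition lfihd_nontrivial :: "'a set \<Rightarrow> (nat \<Rightarrow> 'a \<Rightarrow> 'a::zero) \<Rightarrow> bool" where
  "lfihd_nontrivial A D \<longleftrightarrow> lfihd_kernel A D \<noteq> A"

text \<open>
  A \<open>G\<^sub>a\<close>-action on \<open>Spec A\<close>, given by its comorphism: a homomorphism \<open>\<phi> : A \<rightarrow> A[x]\<close> of
  \<open>k\<close>-algebras satisfying the identity and associativity axioms of an action. The last condition is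
  an equation in \<open>A[x][y]\<close>: applying \<open>\<phi>\<close> to the coefficients of \<open>(\<phi> f)(y)\<close> gives \<open>(\<phi> f)(x + y)\<close>,
  where \<open>x + y\<close> is written \<open>[:[:0, 1:], 1:]\<close>.
\<close>

definition ga_action :: "('k::field \<Rightarrow> 'a::comm_ring_1) \<Rightarrow> 'a set \<Rightarrow> ('a \<Rightarrow> 'a poly) \<Rightarrow> bool" where
  "ga_action \<iota> A \<phi> \<longleftrightarrow>
     (\<forall>f\<in>A. \<forall>i. coeff (\<phi> f) i \<in> A) \<and>
     (\<forall>f\<in>A. \<forall>g\<in>A. \<phi> (f + g) = \<phi> f + \<phi> g) \<and>
     (\<forall>f\<in>A. \<forall>g\<in>A. \<phi> (f * g) = \<phi> f * \<phi> g) \<and>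
     \<phi> 1 = 1 \<and>
     (\<forall>c. \<phi> (\<iota> c) = [:\<iota> c:]) \<and>
     (\<forall>f\<in>A. poly (\<phi> f) 0 = f) \<and>
     (\<forall>f\<in>A. map_poly \<phi> (\<phi> f) =
        poly (map_poly (\<lambda>a. [:[:a:]:]) (\<phi> f)) [:[:0, 1:], 1:])"

definition lfihd_of_action :: "('a \<Rightarrow> 'a poly) \<Rightarrow> nat \<Rightarrow> 'a \<Rightarrow> 'a::zero" where
  "lfihd_of_action \<phi> i f = coeff (\<phi> f) i"

text \<open>The comorphism \<open>e\<^sup>x\<^sup>D\<close>; the sum is finite for \<open>f \<in> A\<close> if \<open>D\<close> is locally finite on \<open>A\<close>.\<close>

definition action_of_lfihd :: "(nat \<Rightarrow> 'a \<Rightarrow> 'a) \<Rightarrow> 'a \<Rightarrow> 'a::comm_ring_1 poly" where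
  "action_of_lfihd D f = (\<Sum>i | D i f \<noteq> 0. monom (D i f) i)"

definition scale_lfihd ::
  "('k::field \<Rightarrow> 'a::comm_ring_1) \<Rightarrow> 'k \<Rightarrow> (nat \<Rightarrow> 'a \<Rightarrow> 'a) \<Rightarrow> nat \<Rightarrow> 'a \<Rightarrow> 'a" where
  "scale_lfihd \<iota> c D i f = \<iota> (c ^ i) * D i f"

subsection \<open>The correspondence between the two notions\<close>

lemma coeff_xy_power:
  "coeff (coeff ([:[:0, 1:], 1::'a::comm_ring_1 poly:] ^ n) j) i =
     (if n = i + j then of_nat (n choose i) else 0)"
proof -
  have x: "[:0, 1::'a:] = monom 1 1"
    by (simp add: monom_altdef)
  show ?thesis
  proof (cases "j \<le> n")
    case True
    then have "coeff ([:[:0, 1:], 1::'a poly:] ^ n) j = of_nat (n choose j) * monom 1 (n - j)"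
      by (subst coeff_linear_poly_power) (simp_all add: x monom_power del: One_nat_def)
    also have "\<dots> = monom (of_nat (n choose j)) (n - j)"
      by (simp add: of_nat_poly smult_monom)
    finally show ?thesis
      using True binomial_symmetric[of j n] by auto
  next
    case False
    have "degree ([:[:0, 1:], 1::'a poly:] ^ n) \<le> n"
      using degree_power_le[of "[:[:0, 1:], 1::'a poly:]" n] by simp
    with False show ?thesis
      by (simp add: coeff_eq_0)
  qed
qed

lemma coassoc_iff:
  assumes "\<phi> 0 = (0 :: 'a::comm_ring_1 poly)"
  shows "map_poly \<phi> (\<phi> f) = poly (map_poly (\<lambda>a. [:[:a:]:]) (\<phi> f)) [:[:0, 1:], 1:] \<longleftrightarrow>
    (\<forall>i j. coeff (\<phi> (coeff (\<phi> f) j)) i = of_nat ((i + j) choose i) * coeff (\<phi> f) (i + j))"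
    (is "?l = ?r \<longleftrightarrow> _")
proof -
  have l: "coeff (coeff ?l j) i = coeff (\<phi> (coeff (\<phi> f) j)) i" for i j
    by (simp add: coeff_map_poly assms)
  have r: "coeff (coeff ?r j) i = of_nat ((i + j) choose i) * coeff (\<phi> f) (i + j)" for i j
  proof -
    let ?p = "\<phi> f"
    have deg: "degree (map_poly (\<lambda>a. [:[:a:]:]) ?p) = degree ?p"
      by (rule degree_map_poly) auto
    have "?r = (\<Sum>n\<le>degree ?p. [:[:coeff ?p n:]:] * [:[:0, 1:], 1:] ^ n)"
      by (simp add: poly_altdef deg coeff_map_poly)
    hence "coeff (coeff ?r j) i =
        (\<Sum>n\<le>degree ?p. coeff ?p n * coeff (coeff ([:[:0, 1:], 1::'a poly:] ^ n) j) i)"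
      by (simp add: coeff_sum)
    also have "\<dots> = (\<Sum>n\<le>degree ?p. if n = i + j
        then of_nat ((i + j) choose i) * coeff ?p (i + j) else 0)"
      by (intro sum.cong) (auto simp: coeff_xy_power)
    also have "\<dots> = of_nat ((i + j) choose i) * coeff ?p (i + j)"
      by (auto simp: coeff_eq_0)
    finally show ?thesis .
  qed
  have "?l = ?r \<longleftrightarrow> (\<forall>i j. coeff (coeff ?l j) i = coeff (coeff ?r j) i)"
    by (auto simp: poly_eq_iff)
  then show ?thesis
    unfolding l r .
qed

lemma lfihd_lfihd_of_action:
  assumes A: "subalgebra \<iota> A" and \<phi>: "ga_action \<iota> A \<phi>"
  shows "lfihd \<iota> A (lfihd_of_action \<phi>)"
proof -
  have "0 \<in> A"
    using A unfolding subalgebra_def by (metis diff_self)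
  then have "\<phi> (0 + 0) = \<phi> 0 + \<phi> 0"
    using \<phi> unfolding ga_action_def by blast
  then have "\<phi> 0 = 0"
    by simp
  from coassoc_iff[of \<phi>, OF this] \<phi> have iter:
    "\<forall>f\<in>A. \<forall>i j. coeff (\<phi> (coeff (\<phi> f) j)) i = of_nat ((i + j) choose i) * coeff (\<phi> f) (i + j)"
    unfolding ga_action_def by blast
  have mem: "coeff (\<phi> f) i \<in> A" and id: "poly (\<phi> f) 0 = f" if "f \<in> A" for f i
    using \<phi> that unfolding ga_action_def by blast+
  have hom: "\<phi> (f + g) = \<phi> f + \<phi> g" "\<phi> (f * g) = \<phi> f * \<phi> g" if "f \<in> A" "g \<in> A" for f g
    using \<phi> that unfolding ga_action_def by blast+
  have const: "\<phi> (\<iota> c) = [:\<iota> c:]" "\<iota> c \<in> A" for c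
    using A \<phi> unfolding ga_action_def subalgebra_def by blast+
  have lf: "\<exists>n. \<forall>i\<ge>n. coeff (\<phi> f) i = 0" for f
    by (intro exI[of _ "Suc (degree (\<phi> f))"]) (auto simp: coeff_eq_0)
  show ?thesis
    unfolding lfihd_def lfihd_of_action_def
  proof (intro conjI allI ballI)
    show "coeff (\<phi> f) 0 = f" if "f \<in> A" for f
      using id[OF that] by (simp add: poly_0_coeff_0)
  qed (use iter lf in \<open>simp_all add: mem hom const coeff_mult\<close>)
qed

lemma coeff_action_of_lfihd:
  assumes "lfihd \<iota> A D" "f \<in> A"
  shows "coeff (action_of_lfihd D f) i = D i f"
proof -
  obtain n where "\<forall>i\<ge>n. D i f = 0"
    using assms unfolding lfihd_def by blast
  then have "{i. D i f \<noteq> 0} \<subseteq> {..<n}"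
    by (auto simp: not_le[symmetric])
  then have "finite {i. D i f \<noteq> 0}"
    using finite_subset by blast
  then show ?thesis
    by (simp add: action_of_lfihd_def coeff_sum)
qed

lemma ga_action_action_of_lfihd:
  assumes A: "subalgebra \<iota> A" and D: "lfihd \<iota> A D"
  shows "ga_action \<iota> A (action_of_lfihd D)"
proof -
  let ?\<phi> = "action_of_lfihd D"
  note c = coeff_action_of_lfihd[OF D]
  have A1: "1 \<in> A" and Ai: "\<iota> x \<in> A" for x
    using A unfolding subalgebra_def by auto
  have A0: "0 \<in> A"
    using A unfolding subalgebra_def by (metis diff_self)
  have cl: "f + g \<in> A" "f * g \<in> A" if "f \<in> A" "g \<in> A" for f g
    using A that unfolding subalgebra_def by auto
  have clD: "D i f \<in> A" if "f \<in> A" for f i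
    using D that unfolding lfihd_def by blast
  have D0: "D 0 f = f" if "f \<in> A" for f
    using D that unfolding lfihd_def by blast
  have mult: "D i (f * g) = (\<Sum>j\<le>i. D j f * D (i - j) g)" if "f \<in> A" "g \<in> A" for f g i
    using D that unfolding lfihd_def by blast
  have add: "D i (f + g) = D i f + D i g" if "f \<in> A" "g \<in> A" for f g i
    using D that unfolding lfihd_def by blast
  have scal: "D i (\<iota> x * f) = \<iota> x * D i f" if "f \<in> A" for f i x
    using D that unfolding lfihd_def by blast
  have it: "D i (D j f) = of_nat ((i + j) choose i) * D (i + j) f" if "f \<in> A" for f i j
    using D that unfolding lfihd_def by blast
  have pm: "?\<phi> (f * g) = ?\<phi> f * ?\<phi> g" if "f \<in> A" "g \<in> A" for f g
    using that by (intro poly_eqI) (simp add: c cl coeff_mult mult)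
  have pa: "?\<phi> (f + g) = ?\<phi> f + ?\<phi> g" if "f \<in> A" "g \<in> A" for f g
    using that by (intro poly_eqI) (simp add: c cl add)
  have D1: "D i 1 = (if i = 0 then 1 else 0)" for i
  proof (induction i rule: less_induct)
    case (less i)
    show ?case
    proof (cases "i = 0")
      case False
      have "D i 1 = (\<Sum>j\<le>i. D j 1 * D (i - j) 1)"
        using mult[OF A1 A1, of i] by (simp only: mult_1)
      also have "\<dots> = (\<Sum>j\<in>{0, i}. D j 1 * D (i - j) 1)"
        using False less.IH by (intro sum.mono_neutral_right) auto
      also have "\<dots> = D i 1 + D i 1"
        using False D0[OF A1] by simp
      finally show ?thesis
        using False by simp
    qed (simp add: D0 A1)
  qed
  have p1: "?\<phi> 1 = 1"
    by (intro poly_eqI) (simp add: c A1 D1 coeff_1)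
  have pi: "?\<phi> (\<iota> x) = [:\<iota> x:]" for x
    using scal[OF A1, of _ x]
    by (intro poly_eqI) (auto simp: c Ai D1 coeff_pCons split: nat.split)
  have "?\<phi> 0 = 0"
    using pa[OF A0 A0] by simp
  note co = coassoc_iff[of ?\<phi>, OF this]
  show ?thesis
    unfolding ga_action_def co
    by (intro conjI allI ballI) (simp_all add: pm pa p1 pi c clD poly_0_coeff_0 D0 it)
qed

section \<open>Cones and Demazure roots\<close>

text \<open>
  A splitting \<open>T \<cong> G\<^sub>m\<^sup>n\<close> identifies both \<open>M\<close> and \<open>N\<close> with \<open>int ^ 'n\<close>, where \<open>n = CARD('n)\<close>, and
  the duality pairing with the standard one; on \<open>M\<^sub>R\<close> and \<open>N\<^sub>R\<close>, both \<open>real ^ 'n\<close>, it is the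
  inner product.
\<close>

definition pairing :: "int ^ 'n \<Rightarrow> int ^ 'n::finite \<Rightarrow> int" where
  "pairing m v = (\<Sum>j\<in>UNIV. m $ j * v $ j)"

definition lattice_vec :: "int ^ 'n \<Rightarrow> real ^ 'n::finite" where
  "lattice_vec v = (\<chi> j. real_of_int (v $ j))"

lemma inner_lattice_vec: "lattice_vec m \<bullet> lattice_vec v = real_of_int (pairing m v)"
  by (simp add: inner_vec_def lattice_vec_def pairing_def)

definition rational_cone :: "(real ^ 'n::finite) set \<Rightarrow> bool" where
  "rational_cone \<sigma> \<longleftrightarrow> (\<exists>S. finite S \<and> \<sigma> = convex_cone hull (lattice_vec ` S))"

definition strongly_convex :: "(real ^ 'n::finite) set \<Rightarrow> bool" where
  "strongly_convex \<sigma> \<longleftrightarrow> {0} face_of \<sigma>"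

definition dual_cone :: "(real ^ 'n::finite) set \<Rightarrow> (real ^ 'n) set" where
  "dual_cone \<sigma> = {m. \<forall>v\<in>\<sigma>. 0 \<le> m \<bullet> v}"

definition dual_monoid :: "(real ^ 'n::finite) set \<Rightarrow> (int ^ 'n) set" where
  "dual_monoid \<sigma> = {m. lattice_vec m \<in> dual_cone \<sigma>}"

text \<open>The zero vector is not primitive, being \<open>2 *s 0\<close>.\<close>

definition primitive :: "int ^ 'n::finite \<Rightarrow> bool" where
  "primitive v \<longleftrightarrow> (\<forall>d w. v = d *s w \<longrightarrow> is_unit d)"

definition extremal_rays :: "(real ^ 'n::finite) set \<Rightarrow> (int ^ 'n) set" where
  "extremal_rays \<sigma> = {\<rho>. primitive \<rho> \<and> conic hull {lattice_vec \<rho>} face_of \<sigma>}"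

definition is_distinguished_ray :: "(real ^ 'n::finite) set \<Rightarrow> int ^ 'n \<Rightarrow> int ^ 'n \<Rightarrow> bool" where
  "is_distinguished_ray \<sigma> e \<rho> \<longleftrightarrow> \<rho> \<in> extremal_rays \<sigma> \<and> pairing e \<rho> = - 1 \<and>
     (\<forall>\<rho>'\<in>extremal_rays \<sigma> - {\<rho>}. 0 \<le> pairing e \<rho>')"

definition demazure_roots :: "(real ^ 'n::finite) set \<Rightarrow> (int ^ 'n) set" where
  "demazure_roots \<sigma> = {e. \<exists>\<rho>. is_distinguished_ray \<sigma> e \<rho>}"

lemma distinguished_ray_unique:
  assumes "is_distinguished_ray \<sigma> e \<rho>" "is_distinguished_ray \<sigma> e \<rho>'"
  shows "\<rho> = \<rho>'"
proof (rule ccontr)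
  assume "\<rho> \<noteq> \<rho>'"
  then have "0 \<le> pairing e \<rho>"
    using assms unfolding is_distinguished_ray_def by blast
  then show False
    using assms unfolding is_distinguished_ray_def by simp
qed

definition distinguished_ray :: "(real ^ 'n::finite) set \<Rightarrow> int ^ 'n \<Rightarrow> int ^ 'n" where
  "distinguished_ray \<sigma> e = (THE \<rho>. is_distinguished_ray \<sigma> e \<rho>)"

lemma distinguished_ray_eq: "is_distinguished_ray \<sigma> e \<rho> \<Longrightarrow> distinguished_ray \<sigma> e = \<rho>"
  unfolding distinguished_ray_def by (blast intro: distinguished_ray_unique)

section \<open>The semigroup algebra of the dual cone\<close>

text \<open>
  The group algebra \<open>k[M]\<close> is the type \<open>(int ^ 'n) \<Rightarrow>\<^sub>0 'k\<close> with its convolution product; \<open>\<chi>\<^sup>m\<close> is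
  \<open>Poly_Mapping.single m 1\<close> and the structure map of the algebra is \<open>Poly_Mapping.single 0\<close>.
\<close>

definition semigroup_algebra ::
  "(real ^ 'n::finite) set \<Rightarrow> ((int ^ 'n) \<Rightarrow>\<^sub>0 'k::field) set" where
  "semigroup_algebra \<sigma> = {f. Poly_Mapping.keys f \<subseteq> dual_monoid \<sigma>}"

definition homogeneous_piece ::
  "(real ^ 'n::finite) set \<Rightarrow> int ^ 'n \<Rightarrow> ((int ^ 'n) \<Rightarrow>\<^sub>0 'k::field) set" where
  "homogeneous_piece \<sigma> m = {f \<in> semigroup_algebra \<sigma>. Poly_Mapping.keys f \<subseteq> {m}}"

definition lfihd_homogeneous ::
  "(real ^ 'n::finite) set \<Rightarrow> int ^ 'n \<Rightarrow>
   (nat \<Rightarrow> ((int ^ 'n) \<Rightarrow>\<^sub>0 'k::field) \<Rightarrow> ((int ^ 'n) \<Rightarrow>\<^sub>0 'k)) \<Rightarrow> bool" where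
  "lfihd_homogeneous \<sigma> e D \<longleftrightarrow>
     (\<forall>i m. \<forall>f\<in>homogeneous_piece \<sigma> m. D i f \<in> homogeneous_piece \<sigma> (m + int i *s e))"

text \<open>
  The operator \<open>\<chi>\<^sup>m \<mapsto> (\<langle>m, \<rho>\<rangle> choose i) \<chi>\<^sup>m\<^sup>+\<^sup>i\<^sup>e\<close>, extended linearly, with \<open>\<rho>\<close> the distinguished ray of
  \<open>e\<close>. On the semigroup algebra \<open>\<langle>m, \<rho>\<rangle>\<close> is nonnegative, so \<open>nat\<close> loses nothing there.
\<close>

definition demazure_lfihd ::
  "(real ^ 'n::finite) set \<Rightarrow> int ^ 'n \<Rightarrow> nat \<Rightarrow>
   ((int ^ 'n) \<Rightarrow>\<^sub>0 'k::field) \<Rightarrow> ((int ^ 'n) \<Rightarrow>\<^sub>0 'k)" where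
  "demazure_lfihd \<sigma> e i f =
     (\<Sum>m\<in>Poly_Mapping.keys f.
        Poly_Mapping.single (m + int i *s e)
          (of_nat (nat (pairing m (distinguished_ray \<sigma> e)) choose i) * Poly_Mapping.lookup f m))"

lemma subalgebra_semigroup_algebra:
  "subalgebra (Poly_Mapping.single 0) (semigroup_algebra \<sigma> :: ((int ^ 'n::finite) \<Rightarrow>\<^sub>0 'k::field) set)"
proof -
  have 0: "0 \<in> dual_monoid \<sigma>"
    by (simp add: dual_monoid_def dual_cone_def lattice_vec_def inner_vec_def)
  have add: "m + m' \<in> dual_monoid \<sigma>" if "m \<in> dual_monoid \<sigma>" "m' \<in> dual_monoid \<sigma>" for m m'
  proof -
    have "lattice_vec (m + m') = lattice_vec m + lattice_vec m'"
      by (simp add: lattice_vec_def vec_eq_iff)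
    then show ?thesis
      using that by (simp add: dual_monoid_def dual_cone_def inner_add_left)
  qed
  have "f * g \<in> semigroup_algebra \<sigma>"
    if "f \<in> semigroup_algebra \<sigma>" "g \<in> semigroup_algebra \<sigma>" for f g :: "(int ^ 'n) \<Rightarrow>\<^sub>0 'k"
    using that keys_mult[of f g] add unfolding semigroup_algebra_def by blast
  moreover have "f + g \<in> semigroup_algebra \<sigma>" "f - g \<in> semigroup_algebra \<sigma>"
    if "f \<in> semigroup_algebra \<sigma>" "g \<in> semigroup_algebra \<sigma>" for f g :: "(int ^ 'n) \<Rightarrow>\<^sub>0 'k"
    using that Poly_Mapping.keys_add[of f g] keys_diff[of f g]
    unfolding semigroup_algebra_def by blast+
  moreover have "Poly_Mapping.single 0 c \<in> semigroup_algebra \<sigma>" for c :: 'k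
    using 0 by (simp add: semigroup_algebra_def)
  moreover from this[of 1] have "(1 :: (int ^ 'n) \<Rightarrow>\<^sub>0 'k) \<in> semigroup_algebra \<sigma>"
    by simp
  ultimately show ?thesis
    unfolding subalgebra_def by auto
qed

end

theory Submission
  imports Defs
begin

text \<open>
  Let \<open>S = \<sigma>\<^sup>\<or> \<inter> M\<close> and let \<open>e\<close> be the degree of the action. Homogeneity means that
  \<open>\<phi> (\<chi>\<^sup>m) = \<chi>\<^sup>m P\<^sub>m (\<chi>\<^sup>e x)\<close> for a polynomial \<open>P\<^sub>m \<in> k[x]\<close> with constant term \<open>1\<close>, called the symbol of \<open>m\<close>
  below, and that \<open>m + i e \<in> S\<close> whenever \<open>x\<^sup>i\<close> occurs in \<open>P\<^sub>m\<close>. The whole action is encoded in these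
  polynomials, and two of its axioms determine them. As \<open>\<phi>\<close> is multiplicative,
  \<open>P\<^sub>m\<^sub>+\<^sub>m\<^sub>' = P\<^sub>m P\<^sub>m\<^sub>'\<close> (\<open>symbol_add\<close>). As \<open>\<partial>\<^sup>i \<circ> \<partial>\<^sup>d = (i + d choose i) \<partial>\<^sup>i\<^sup>+\<^sup>d\<close>, nothing is left to apply after the
  top order \<open>d = deg P\<^sub>m\<close>, so \<open>P\<^sub>m\<^sub>+\<^sub>d\<^sub>e = 1\<close> (\<open>symbol_top_shift\<close>). This holds in every characteristic, whereas
  the individual binomial coefficients may vanish.
  
  If \<open>d > 0\<close>, the point \<open>u = m + (d - 1) e\<close> lies on the segment from \<open>m\<close> to \<open>m + d e\<close>, hence in \<open>S\<close>, and
  \<open>P\<^sub>u\<^sup>d = P\<^sub>m\<close> forces \<open>P\<^sub>u = 1 + c x\<close> with \<open>c \<noteq> 0\<close> (\<open>linear_symbol\<close>). As \<open>P\<^sub>u\<^sub>+\<^sub>e = 1\<close>, comparing the two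
  decompositions of \<open>m + d (u + e)\<close> gives \<open>P\<^sub>m = (1 + c x)\<^sup>d\<close> for every \<open>m \<in> S\<close>, with \<open>d = deg P\<^sub>m\<close>
  (\<open>symbol_eq_power\<close>).
  
  It remains to recognise the exponent. The function \<open>m \<mapsto> deg P\<^sub>m\<close> is additive on \<open>S\<close>, and \<open>S\<close> generates
  \<open>M\<close> because \<open>\<sigma>\<close> is strongly convex, so \<open>deg P\<^sub>m = \<langle>m, \<rho>\<rangle>\<close> for some \<open>\<rho> \<in> N\<close> (\<open>additive_is_pairing\<close>);
  the points \<open>u\<close> and \<open>u + e\<close> give \<open>\<langle>e, \<rho>\<rangle> = -1\<close>. The inclusion \<open>m + \<langle>m, \<rho>\<rangle> e \<in> S\<close> for \<open>m \<in> S\<close> says, dually,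
  that the projection \<open>v \<mapsto> v + \<langle>e, v\<rangle> \<rho>\<close> along \<open>\<rho>\<close> maps \<open>\<sigma>\<close> into itself. This makes \<open>\<rho>\<close> an extremal
  ray, and the only one on which \<open>e\<close> is negative (\<open>distinguished_ray_if_degree\<close>).
\<close>


section \<open>Lattice points and pointed rational cones\<close>

lemma lattice_vec_simps [simp]:
  "lattice_vec (m + m') = lattice_vec m + lattice_vec m'"
  "lattice_vec (c *s m) = of_int c *\<^sub>R lattice_vec m"
  "lattice_vec 0 = 0"
  by (simp_all add: lattice_vec_def vec_eq_iff)

lemma lattice_vec_eq_iff [simp]: "lattice_vec v = lattice_vec w \<longleftrightarrow> v = w"
  by (simp add: lattice_vec_def vec_eq_iff)

lemma pairing_simps [simp]:
  "pairing (m + m') v = pairing m v + pairing m' v"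
  "pairing (c *s m) v = c * pairing m v"
  "pairing m (c *s v) = c * pairing m v"
  by (simp_all add: pairing_def algebra_simps sum.distrib sum_distrib_left)

text \<open>
  Finitely many strict inequalities survive a small perturbation and a positive rescaling, so \<open>a\<close> may be
  replaced by the coordinatewise floor of a large multiple of itself: the rounding error of
  \<open>N * (a \<bullet> g)\<close> stays below the sum of the \<open>\<bar>g $ j\<bar>\<close>, whatever \<open>N\<close> is.
\<close>

lemma integral_positive_functional:
  fixes a :: "real ^ 'n::finite"
  assumes "finite G" and pos: "\<And>g. g \<in> G \<Longrightarrow> 0 < a \<bullet> g"
  obtains w :: "int ^ 'n" where "\<And>g. g \<in> G \<Longrightarrow> 0 < lattice_vec w \<bullet> g"
proof -
  define w :: "nat \<Rightarrow> int ^ 'n" where "w N = (\<chi> j. \<lfloor>real N * a $ j\<rfloor>)" for N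
  have "\<forall>\<^sub>F N in sequentially. 0 < lattice_vec (w N) \<bullet> g" if g: "g \<in> G" for g
  proof -
    define C where "C = (\<Sum>j\<in>UNIV. \<bar>g $ j\<bar>)"
    have close: "real N * (a \<bullet> g) - C \<le> lattice_vec (w N) \<bullet> g" for N
    proof -
      have "real N * (a \<bullet> g) - lattice_vec (w N) \<bullet> g
          = (\<Sum>j\<in>UNIV. (real N * a $ j - of_int \<lfloor>real N * a $ j\<rfloor>) * g $ j)"
        by (simp add: inner_vec_def lattice_vec_def w_def sum_distrib_left
            algebra_simps sum_subtractf)
      also have "\<dots> \<le> C"
        unfolding C_def
      proof (rule sum_mono)
        fix j :: 'n
        have "\<bar>real N * a $ j - of_int \<lfloor>real N * a $ j\<rfloor>\<bar> \<le> 1"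
          by linarith
        then have "\<bar>real N * a $ j - of_int \<lfloor>real N * a $ j\<rfloor>\<bar> * \<bar>g $ j\<bar> \<le> 1 * \<bar>g $ j\<bar>"
          by (rule mult_right_mono) simp
        then show "(real N * a $ j - of_int \<lfloor>real N * a $ j\<rfloor>) * g $ j \<le> \<bar>g $ j\<bar>"
          unfolding abs_mult[symmetric] by linarith
      qed
      finally show ?thesis
        by simp
    qed
    obtain N0 :: nat where N0: "C < real N0 * (a \<bullet> g)"
      using reals_Archimedean3[OF pos[OF g]] by blast
    have "0 < lattice_vec (w N) \<bullet> g" if "N0 \<le> N" for N
    proof -
      have "real N0 * (a \<bullet> g) \<le> real N * (a \<bullet> g)"
        using that pos[OF g] by (simp add: mult_right_mono)
      with N0 close[of N] show ?thesis
        by linarith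
    qed
    then show ?thesis
      unfolding eventually_sequentially by blast
  qed
  then have "\<forall>\<^sub>F N in sequentially. \<forall>g\<in>G. 0 < lattice_vec (w N) \<bullet> g"
    using \<open>finite G\<close> by (simp add: eventually_ball_finite)
  then show thesis
    using that by (auto simp: eventually_sequentially)
qed

locale pointed_rational_cone =
  fixes \<sigma> :: "(real ^ 'n::finite) set"
  assumes rational: "rational_cone \<sigma>" and pointed: "strongly_convex \<sigma>"
begin

lemma convex_cone: "convex_cone \<sigma>"
  using rational convex_cone_convex_cone_hull unfolding rational_cone_def by auto

lemma add_mem: "a \<in> \<sigma> \<Longrightarrow> b \<in> \<sigma> \<Longrightarrow> a + b \<in> \<sigma>"
  by (rule convex_cone_add[OF convex_cone])

lemma scale_mem: "0 \<le> c \<Longrightarrow> a \<in> \<sigma> \<Longrightarrow> c *\<^sub>R a \<in> \<sigma>"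
  by (rule convex_cone_scaleR[OF convex_cone])

text \<open>
  Strong convexity in the form used below: \<open>\<sigma>\<close> contains no pair of opposite nonzero vectors.
\<close>

lemma sum_eq_0_imp:
  assumes "a \<in> \<sigma>" "b \<in> \<sigma>" "a + b = 0"
  shows "a = 0"
proof (cases "a = b")
  case True
  with \<open>a + b = 0\<close> show ?thesis
    by (simp add: scaleR_2[symmetric])
next
  case False
  have "0 \<in> open_segment a b"
    unfolding in_segment using False \<open>a + b = 0\<close>
    by (auto intro!: exI[of _ "1/2"] simp: scaleR_add_right[symmetric])
  then show ?thesis
    using pointed assms unfolding strongly_convex_def face_of_def by blast
qed

lemma dual_monoid_iff: "m \<in> dual_monoid \<sigma> \<longleftrightarrow> (\<forall>v\<in>\<sigma>. 0 \<le> lattice_vec m \<bullet> v)"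
  by (simp add: dual_monoid_def dual_cone_def)

lemma dual_monoid_add: "m \<in> dual_monoid \<sigma> \<Longrightarrow> m' \<in> dual_monoid \<sigma> \<Longrightarrow> m + m' \<in> dual_monoid \<sigma>"
  by (simp add: dual_monoid_iff inner_add_left)

lemma dual_monoid_0: "0 \<in> dual_monoid \<sigma>"
  by (simp add: dual_monoid_iff)

lemma dual_monoid_scale: "m \<in> dual_monoid \<sigma> \<Longrightarrow> int k *s m \<in> dual_monoid \<sigma>"
  by (simp add: dual_monoid_iff)

lemma dual_monoid_saturated:
  assumes "int k *s m \<in> dual_monoid \<sigma>" "0 < k"
  shows "m \<in> dual_monoid \<sigma>"
  using assms by (simp add: dual_monoid_iff zero_le_mult_iff)

lemma generators:
  obtains S where "finite S" "0 \<notin> S" "\<sigma> = convex_cone hull (lattice_vec ` S)"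
proof -
  obtain S where S: "finite S" "\<sigma> = convex_cone hull (lattice_vec ` S)"
    using rational unfolding rational_cone_def by blast
  have "convex_cone hull (lattice_vec ` S) = convex_cone hull (lattice_vec ` (S - {0}))"
  proof (rule antisym)
    have "x \<in> convex_cone hull (lattice_vec ` (S - {0}))" if "x \<in> lattice_vec ` S" for x
    proof (cases "x = 0")
      case False
      with that show ?thesis
        by (intro hull_inc) auto
    qed (simp add: convex_cone_hull_contains_0)
    then show "convex_cone hull (lattice_vec ` S) \<subseteq> convex_cone hull (lattice_vec ` (S - {0}))"
      by (intro hull_minimal) (auto simp: convex_cone_convex_cone_hull)
  qed (intro hull_mono, auto)
  with S that[of "S - {0}"] show thesis
    by auto
qed

text \<open>
  As \<open>0\<close> is a face of \<open>\<sigma>\<close>, the convex hull of the nonzero generators misses \<open>0\<close> and can be strictly separated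
  from it. The separating functional is then made integral, which yields a lattice point in the
  interior of the dual cone.
\<close>

lemma interior_lattice_point:
  obtains S w where "finite S" "\<sigma> = convex_cone hull (lattice_vec ` S)"
    "\<And>s. s \<in> S \<Longrightarrow> 0 < pairing w s"
proof -
  obtain S where S: "finite S" "0 \<notin> S" "\<sigma> = convex_cone hull (lattice_vec ` S)"
    using generators .
  let ?G = "lattice_vec ` S"
  have "?G \<subseteq> \<sigma> - {0}"
    using S hull_inc[of _ ?G] by (auto simp flip: lattice_vec_simps(3))
  moreover have "convex (\<sigma> - {0})"
  proof (rule convexI)
    fix x y and u v :: real
    assume x: "x \<in> \<sigma> - {0}" and y: "y \<in> \<sigma> - {0}" and uv: "0 \<le> u" "0 \<le> v" "u + v = 1"
    have mem: "u *\<^sub>R x \<in> \<sigma>" "v *\<^sub>R y \<in> \<sigma>"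
      using x y uv by (auto intro: scale_mem)
    have "u *\<^sub>R x + v *\<^sub>R y \<noteq> 0"
    proof
      assume "u *\<^sub>R x + v *\<^sub>R y = 0"
      moreover from this have "u *\<^sub>R x = 0"
        by (rule sum_eq_0_imp[OF mem])
      ultimately show False
        using x y uv by auto
    qed
    then show "u *\<^sub>R x + v *\<^sub>R y \<in> \<sigma> - {0}"
      using add_mem[OF mem] by blast
  qed
  ultimately have "convex hull ?G \<subseteq> \<sigma> - {0}"
    by (rule hull_minimal)
  then have "0 \<notin> convex hull ?G"
    by blast
  moreover have "closed (convex hull ?G)"
    using S by (simp add: compact_imp_closed finite_imp_compact_convex_hull)
  ultimately obtain a b where "0 < b" "\<forall>x\<in>convex hull ?G. a \<bullet> x > b"
    using separating_hyperplane_closed_0[of "convex hull ?G"] by auto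
  then have "0 < a \<bullet> g" if "g \<in> ?G" for g
    using that hull_inc[of g ?G convex] by fastforce
  then obtain w where "\<And>g. g \<in> ?G \<Longrightarrow> 0 < lattice_vec w \<bullet> g"
    using integral_positive_functional[of ?G a] S(1) by blast
  then have "0 < pairing w s" if "s \<in> S" for s
    using that by (metis imageI inner_lattice_vec of_int_0_less_iff)
  with S that show thesis
    by blast
qed

lemma dual_monoid_hull_iff:
  assumes "\<sigma> = convex_cone hull G"
  shows "m \<in> dual_monoid \<sigma> \<longleftrightarrow> (\<forall>g\<in>G. 0 \<le> lattice_vec m \<bullet> g)"
proof
  show "\<forall>g\<in>G. 0 \<le> lattice_vec m \<bullet> g" if "m \<in> dual_monoid \<sigma>"
    using that hull_inc[of _ G convex_cone] assms unfolding dual_monoid_iff by blast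
next
  assume "\<forall>g\<in>G. 0 \<le> lattice_vec m \<bullet> g"
  then have "convex_cone hull G \<subseteq> {x. lattice_vec m \<bullet> x \<ge> 0}"
    by (intro hull_minimal) (auto simp: convex_cone_halfspace_ge)
  then show "m \<in> dual_monoid \<sigma>"
    unfolding dual_monoid_iff using assms by blast
qed

text \<open>
  Adding a large multiple of an interior lattice point moves any \<open>m\<close> into the dual cone. Hence every
  \<open>m\<close> is a difference of two points of the dual monoid.
\<close>

lemma dual_monoid_generates:
  obtains w where "w \<in> dual_monoid \<sigma>" "\<And>m. \<exists>k::nat. m + int k *s w \<in> dual_monoid \<sigma>"
proof -
  obtain S w where S: "finite S" "\<sigma> = convex_cone hull (lattice_vec ` S)"
    and w: "\<And>s. s \<in> S \<Longrightarrow> 0 < pairing w s"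
    using interior_lattice_point by blast
  have iff: "m \<in> dual_monoid \<sigma> \<longleftrightarrow> (\<forall>s\<in>S. 0 \<le> pairing m s)" for m
    by (simp add: dual_monoid_hull_iff[OF S(2)] inner_lattice_vec)
  have "m + int (\<Sum>s\<in>S. nat \<bar>pairing m s\<bar>) *s w \<in> dual_monoid \<sigma>" for m
    unfolding iff
  proof
    fix s assume s: "s \<in> S"
    \<comment> \<open>The multiple dominates every \<open>\<bar>pairing m s\<bar>\<close>, and \<open>pairing w s \<ge> 1\<close> by integrality.\<close>
    let ?k = "\<Sum>s\<in>S. nat \<bar>pairing m s\<bar>"
    have "nat \<bar>pairing m s\<bar> \<le> ?k"
      using S(1) s by (intro member_le_sum) auto
    then have "\<bar>pairing m s\<bar> \<le> int ?k"
      by linarith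
    also have "int ?k * 1 \<le> int ?k * pairing w s"
      using w[OF s] by (intro mult_left_mono) auto
    finally show "0 \<le> pairing (m + int ?k *s w) s"
      by simp
  qed
  moreover have "w \<in> dual_monoid \<sigma>"
    using w by (auto simp: iff less_imp_le)
  ultimately show thesis
    using that by blast
qed

text \<open>
  The bidual theorem, tested on lattice points only. A real functional separating \<open>v\<close> from \<open>\<sigma>\<close> need not be
  positive on the generators; adding a small multiple of an interior lattice point makes it so
  while keeping it negative at \<open>v\<close>, and then it can be made integral.
\<close>

lemma mem_if_dual_nonneg:
  assumes nonneg: "\<And>m. m \<in> dual_monoid \<sigma> \<Longrightarrow> 0 \<le> lattice_vec m \<bullet> v"
  shows "v \<in> \<sigma>"
proof (rule ccontr)
  assume "v \<notin> \<sigma>"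
  obtain S w where S: "finite S" "\<sigma> = convex_cone hull (lattice_vec ` S)"
    and w: "\<And>s. s \<in> S \<Longrightarrow> 0 < pairing w s"
    using interior_lattice_point by blast
  let ?G = "lattice_vec ` S"
  have "closed \<sigma>"
    using S closed_convex_cone_hull[of ?G] by simp
  then obtain a b where ab: "a \<bullet> v < b" "\<And>x. x \<in> \<sigma> \<Longrightarrow> b < a \<bullet> x"
    using separating_hyperplane_closed_point[of \<sigma> v] convex_cone \<open>v \<notin> \<sigma>\<close>
    unfolding convex_cone_def by blast
  have "b < 0"
    using ab(2)[of 0] convex_cone_contains_0[OF convex_cone] by simp
  \<comment> \<open>On a cone, a functional that is bounded below is nonnegative.\<close>
  have a: "0 \<le> a \<bullet> x" if x: "x \<in> \<sigma>" for x
  proof (rule ccontr)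
    assume neg: "\<not> 0 \<le> a \<bullet> x"
    then have "(b / (a \<bullet> x)) *\<^sub>R x \<in> \<sigma>"
      using x \<open>b < 0\<close> by (intro scale_mem) (auto simp: divide_nonpos_nonpos)
    from ab(2)[OF this] neg show False
      by simp
  qed
  \<comment> \<open>If \<open>w\<close> is positive at \<open>v\<close>, this choice halves the value \<open>a \<bullet> v\<close>.\<close>
  define \<epsilon> where "\<epsilon> = (if lattice_vec w \<bullet> v \<le> 0 then 1 else - (a \<bullet> v) / (2 * (lattice_vec w \<bullet> v)))"
  have "0 < - (a \<bullet> v)"
    using ab(1) \<open>b < 0\<close> by simp
  then have \<epsilon>: "0 < \<epsilon>" "0 < (a + \<epsilon> *\<^sub>R lattice_vec w) \<bullet> (- v)"
    by (auto simp: \<epsilon>_def inner_add_left divide_simps add_pos_nonneg)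
  have "0 < (a + \<epsilon> *\<^sub>R lattice_vec w) \<bullet> g" if "g \<in> insert (- v) ?G" for g
  proof (cases "g = - v")
    case False
    then have "g \<in> ?G"
      using that by blast
    then have "0 \<le> a \<bullet> g" "0 < lattice_vec w \<bullet> g"
      using a hull_inc[of g ?G] S(2) w by (auto simp: inner_lattice_vec)
    with \<epsilon>(1) show ?thesis
      by (simp add: inner_add_left add_nonneg_pos)
  qed (use \<epsilon>(2) in simp)
  then obtain m where m: "\<And>g. g \<in> insert (- v) ?G \<Longrightarrow> 0 < lattice_vec m \<bullet> g"
    using integral_positive_functional[of "insert (- v) ?G"] S(1) by blast
  then have "m \<in> dual_monoid \<sigma>"
    by (auto simp: dual_monoid_hull_iff[OF S(2)] less_imp_le)
  from nonneg[OF this] m[of "- v"] show False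
    by simp
qed

text \<open>
  As the dual monoid generates \<open>M\<close>, the function \<open>l\<close> extends to a homomorphism \<open>L\<close> on \<open>M\<close>, given by
  \<open>L m = l (m + k w) - k l w\<close> for any \<open>k\<close> with \<open>m + k w\<close> in the monoid. Its values on the standard basis are
  the coordinates of \<open>\<rho>\<close>.
\<close>

lemma additive_is_pairing:
  fixes l :: "int ^ 'n \<Rightarrow> nat"
  assumes add: "\<And>m m'. m \<in> dual_monoid \<sigma> \<Longrightarrow> m' \<in> dual_monoid \<sigma> \<Longrightarrow> l (m + m') = l m + l m'"
  obtains \<rho> where "\<And>m. m \<in> dual_monoid \<sigma> \<Longrightarrow> int (l m) = pairing m \<rho>"
proof -
  obtain w k where w: "w \<in> dual_monoid \<sigma>" and k: "\<And>m. m + int (k m) *s w \<in> dual_monoid \<sigma>"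
    using dual_monoid_generates by metis
  have l0: "l 0 = 0"
    using add[OF dual_monoid_0 dual_monoid_0] by simp
  have lk: "l (int j *s m) = j * l m" if "m \<in> dual_monoid \<sigma>" for j m
  proof (induction j)
    case (Suc j)
    have "int (Suc j) *s m = m + int j *s m"
      by simp
    with Suc show ?case
      using add[OF that dual_monoid_scale[OF that]] by simp
  qed (simp add: l0)
  define L where "L m = int (l (m + int (k m) *s w)) - int (k m * l w)" for m
  have L: "L m = int (l (m + int j *s w)) - int (j * l w)" if "m + int j *s w \<in> dual_monoid \<sigma>" for m j
  proof -
    have "l (m + int j *s w) + k m * l w = l (m + int (k m) *s w) + j * l w"
      using add[OF that dual_monoid_scale[OF w, of "k m"]]
        add[OF k[of m] dual_monoid_scale[OF w, of j]]
      by (simp add: lk w algebra_simps)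
    then have "int (l (m + int j *s w)) + int (k m * l w)
        = int (l (m + int (k m) *s w)) + int (j * l w)"
      by (simp only: flip: of_nat_add)
    then show ?thesis
      unfolding L_def by linarith
  qed
  have L_add: "L (m + m') = L m + L m'" for m m'
  proof -
    have eq: "(m + int (k m) *s w) + (m' + int (k m') *s w) = (m + m') + int (k m + k m') *s w"
      by simp
    have "m + m' + int (k m + k m') *s w \<in> dual_monoid \<sigma>"
      using dual_monoid_add[OF k[of m] k[of m']] by (simp only: eq)
    from L[OF this] show ?thesis
      using add[OF k[of m] k[of m']] unfolding eq by (simp add: L_def algebra_simps)
  qed
  interpret L: additive L
    by standard (rule L_add)
  have L_scale: "L (c *s m) = c * L m" for c m
  proof -
    have "L (int j *s m) = int j * L m" for j
      by (induction j) (simp_all add: L_add L.zero algebra_simps)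
    moreover have "L (- int j *s m) = - L (int j *s m)" for j
      using L.minus[of "int j *s m"] by (simp add: vector_smult_lneg)
    ultimately show ?thesis
      by (cases c rule: int_cases2) auto
  qed
  have "L m = pairing m (\<chi> j. L (axis j 1))" for m
  proof -
    have "m = (\<Sum>j\<in>UNIV. (m $ j) *s axis j 1)"
      by (simp add: vec_eq_iff axis_def if_distrib cong: if_cong)
    then have "L m = (\<Sum>j\<in>UNIV. L ((m $ j) *s axis j 1))"
      using L.sum by metis
    then show ?thesis
      by (simp add: L_scale pairing_def)
  qed
  moreover have "L m = int (l m)" if "m \<in> dual_monoid \<sigma>" for m
    using L[of m 0] that by simp
  ultimately show thesis
    using that by metis
qed

end

section \<open>Symbols of a homogeneous action\<close>

lemma poly_mapping_sum_single:
  "f = (\<Sum>m\<in>Poly_Mapping.keys f. Poly_Mapping.single m (Poly_Mapping.lookup f m))"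
  by (rule poly_mapping_eqI) (simp add: lookup_sum lookup_single when_def in_keys_iff)

locale homogeneous_ga_action = pointed_rational_cone \<sigma>
  for \<sigma> :: "(real ^ 'n::finite) set" +
  fixes \<phi> :: "((int ^ 'n) \<Rightarrow>\<^sub>0 'k::field) \<Rightarrow> ((int ^ 'n) \<Rightarrow>\<^sub>0 'k) poly"
    and e :: "int ^ 'n"
  assumes action: "ga_action (Poly_Mapping.single 0 :: 'k \<Rightarrow> _) (semigroup_algebra \<sigma>) \<phi>"
    and homogeneous: "lfihd_homogeneous \<sigma> e (lfihd_of_action \<phi>)"
begin

abbreviation character :: "int ^ 'n \<Rightarrow> (int ^ 'n) \<Rightarrow>\<^sub>0 'k" where
  "character m \<equiv> Poly_Mapping.single m 1"

text \<open>
  The polynomial \<open>P\<^sub>m\<close> with \<open>\<phi> (\<chi>\<^sup>m) = \<chi>\<^sup>m P\<^sub>m (\<chi>\<^sup>e x)\<close>: the coefficient of \<open>x\<^sup>i\<close> is the scalar by which \<open>\<partial>\<^sup>i\<close>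
  takes \<open>\<chi>\<^sup>m\<close> to \<open>\<chi>\<^sup>m\<^sup>+\<^sup>i\<^sup>e\<close>.
\<close>

definition symbol :: "int ^ 'n \<Rightarrow> 'k poly" where
  "symbol m = (\<Sum>i\<le>degree (\<phi> (character m)).
     monom (Poly_Mapping.lookup (coeff (\<phi> (character m)) i) (m + int i *s e)) i)"

lemma lfihd: "lfihd (Poly_Mapping.single 0) (semigroup_algebra \<sigma>) (lfihd_of_action \<phi>)"
  by (rule lfihd_lfihd_of_action[OF subalgebra_semigroup_algebra action])

lemma single_mem: "m \<in> dual_monoid \<sigma> \<Longrightarrow> Poly_Mapping.single m (c :: 'k) \<in> semigroup_algebra \<sigma>"
  by (simp add: semigroup_algebra_def)

lemma coeff_symbol:
  "coeff (symbol m) i = Poly_Mapping.lookup (coeff (\<phi> (character m)) i) (m + int i *s e)"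
  by (simp add: symbol_def coeff_sum coeff_eq_0)

lemma coeff_action_single:
  assumes "m \<in> dual_monoid \<sigma>"
  shows "coeff (\<phi> (character m)) i = Poly_Mapping.single (m + int i *s e) (coeff (symbol m) i)"
    and "coeff (symbol m) i \<noteq> 0 \<Longrightarrow> m + int i *s e \<in> dual_monoid \<sigma>"
proof -
  have "character m \<in> homogeneous_piece \<sigma> m"
    using single_mem[OF assms] by (simp add: homogeneous_piece_def)
  then have hp: "coeff (\<phi> (character m)) i \<in> homogeneous_piece \<sigma> (m + int i *s e)"
    using homogeneous unfolding lfihd_homogeneous_def lfihd_of_action_def by blast
  then have keys: "Poly_Mapping.keys (coeff (\<phi> (character m)) i) \<subseteq> {m + int i *s e}"
    by (simp add: homogeneous_piece_def)
  show "coeff (\<phi> (character m)) i = Poly_Mapping.single (m + int i *s e) (coeff (symbol m) i)"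
  proof (rule poly_mapping_eqI)
    fix x
    show "Poly_Mapping.lookup (coeff (\<phi> (character m)) i) x
        = Poly_Mapping.lookup (Poly_Mapping.single (m + int i *s e) (coeff (symbol m) i)) x"
      using keys by (auto simp: coeff_symbol lookup_single when_def simp flip: not_in_keys_iff_lookup_eq_zero)
  qed
  show "m + int i *s e \<in> dual_monoid \<sigma>" if "coeff (symbol m) i \<noteq> 0"
    using that hp
    by (auto simp: coeff_symbol homogeneous_piece_def semigroup_algebra_def simp flip: in_keys_iff)
qed

lemma symbol_add:
  assumes "m \<in> dual_monoid \<sigma>" "m' \<in> dual_monoid \<sigma>"
  shows "symbol (m + m') = symbol m * symbol m'"
proof (rule poly_eqI)
  fix i
  have deg: "m + int j *s e + (m' + int (i - j) *s e) = m + m' + int i *s e" if "j \<le> i" for j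
    using that by (simp add: vec_eq_iff algebra_simps)
  have "coeff (\<phi> (character m * character m')) i = coeff (\<phi> (character m) * \<phi> (character m')) i"
    using action single_mem[OF assms(1)] single_mem[OF assms(2)] unfolding ga_action_def by simp
  also have "\<dots> = (\<Sum>j\<le>i. Poly_Mapping.single (m + m' + int i *s e)
      (coeff (symbol m) j * coeff (symbol m') (i - j)))"
    by (simp add: coeff_mult coeff_action_single assms mult_single deg add.assoc)
  finally show "coeff (symbol (m + m')) i = coeff (symbol m * symbol m') i"
    by (simp add: mult_single coeff_symbol[of "m + m'"] lookup_sum coeff_mult)
qed

lemma coeff_symbol_0:
  assumes "m \<in> dual_monoid \<sigma>"
  shows "coeff (symbol m) 0 = 1"
  using action single_mem[OF assms, of 1]
  unfolding ga_action_def by (simp add: coeff_symbol poly_0_coeff_0)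

lemma symbol_nonzero: "m \<in> dual_monoid \<sigma> \<Longrightarrow> symbol m \<noteq> 0"
  using coeff_symbol_0[of m] by auto

lemma degree_symbol_add:
  "m \<in> dual_monoid \<sigma> \<Longrightarrow> m' \<in> dual_monoid \<sigma> \<Longrightarrow>
    degree (symbol (m + m')) = degree (symbol m) + degree (symbol m')"
  by (simp add: symbol_add symbol_nonzero degree_mult_eq)

lemma symbol_scale:
  assumes "m \<in> dual_monoid \<sigma>"
  shows "symbol (int k *s m) = symbol m ^ k"
proof (induction k)
  case 0
  have "symbol 0 * symbol 0 = symbol 0"
    using symbol_add[OF dual_monoid_0 dual_monoid_0] by simp
  then have "symbol 0 = 1"
    using symbol_nonzero[OF dual_monoid_0] by simp
  then show ?case
    by simp
next
  case (Suc k)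
  then show ?case
    using symbol_add[OF assms dual_monoid_scale[OF assms, of k]] by simp
qed

text \<open>
  The iterativity axiom \<open>\<partial>\<^sup>i \<circ> \<partial>\<^sup>j = (i + j choose i) \<partial>\<^sup>i\<^sup>+\<^sup>j\<close>, evaluated at \<open>\<chi>\<^sup>m\<close>.
\<close>

lemma symbol_shift:
  assumes m: "m \<in> dual_monoid \<sigma>" and mj: "m + int j *s e \<in> dual_monoid \<sigma>"
  shows "coeff (symbol m) j * coeff (symbol (m + int j *s e)) i
    = of_nat ((i + j) choose i) * coeff (symbol m) (i + j)"
proof -
  let ?D = "lfihd_of_action \<phi>"
  have deg: "m + int j *s e + int i *s e = m + int (i + j) *s e"
    by simp
  have "?D j (character m) = Poly_Mapping.single 0 (coeff (symbol m) j) * character (m + int j *s e)"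
    by (simp add: lfihd_of_action_def coeff_action_single[OF m] mult_single)
  then have "?D i (?D j (character m))
      = Poly_Mapping.single 0 (coeff (symbol m) j) * ?D i (character (m + int j *s e))"
    using lfihd single_mem[OF mj] unfolding lfihd_def by simp
  also have "\<dots> = Poly_Mapping.single (m + int (i + j) *s e)
      (coeff (symbol m) j * coeff (symbol (m + int j *s e)) i)"
    by (simp only: lfihd_of_action_def coeff_action_single[OF mj] mult_single deg add_0)
  finally have "Poly_Mapping.single (m + int (i + j) *s e)
      (coeff (symbol m) j * coeff (symbol (m + int j *s e)) i)
      = of_nat ((i + j) choose i) * ?D (i + j) (character m)"
    using lfihd single_mem[OF m] unfolding lfihd_def by metis
  also have "\<dots> = Poly_Mapping.single (m + int (i + j) *s e)
      (of_nat ((i + j) choose i) * coeff (symbol m) (i + j))"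
    by (simp only: lfihd_of_action_def coeff_action_single[OF m] mult_single add_0
        flip: single_of_nat)
  finally show ?thesis
    by (metis lookup_single_eq)
qed

text \<open>
  With \<open>j\<close> the degree of the symbol, the right-hand side of \<open>symbol_shift\<close> vanishes for \<open>i > 0\<close>, while the
  leading coefficient on the left does not.
\<close>

lemma symbol_top_shift:
  assumes m: "m \<in> dual_monoid \<sigma>"
  defines "m' \<equiv> m + int (degree (symbol m)) *s e"
  shows "m' \<in> dual_monoid \<sigma>" "symbol m' = 1"
proof -
  let ?d = "degree (symbol m)"
  have lead: "coeff (symbol m) ?d \<noteq> 0"
    using symbol_nonzero[OF m] by simp
  then show m': "m' \<in> dual_monoid \<sigma>"
    unfolding m'_def by (rule coeff_action_single(2)[OF m])
  have "coeff (symbol m') i = 0" if "0 < i" for i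
    using symbol_shift[OF m, of ?d i] m' lead that by (simp add: m'_def coeff_eq_0)
  then show "symbol m' = 1"
    using coeff_symbol_0[OF m'] by (intro poly_eqI) (simp add: coeff_1)
qed

text \<open>
  By linearity the symbols determine the action on the whole semigroup algebra.
\<close>

lemma lfihd_of_action_eq_sum:
  assumes "f \<in> semigroup_algebra \<sigma>"
  shows "lfihd_of_action \<phi> i f = (\<Sum>m\<in>Poly_Mapping.keys f.
    Poly_Mapping.single (m + int i *s e) (coeff (symbol m) i * Poly_Mapping.lookup f m))"
proof -
  let ?D = "lfihd_of_action \<phi>" and ?A = "semigroup_algebra \<sigma> :: ((int ^ 'n) \<Rightarrow>\<^sub>0 'k) set"
  have D_single: "?D i (Poly_Mapping.single m c)
      = Poly_Mapping.single (m + int i *s e) (coeff (symbol m) i * c)"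
    if m: "m \<in> dual_monoid \<sigma>" for m c
  proof -
    have "?D i (Poly_Mapping.single 0 c * character m) = Poly_Mapping.single 0 c * ?D i (character m)"
      using lfihd single_mem[OF m] unfolding lfihd_def by blast
    then show ?thesis
      by (simp add: mult_single lfihd_of_action_def coeff_action_single[OF m] mult.commute)
  qed
  have zero: "0 \<in> ?A"
    by (simp add: semigroup_algebra_def)
  have add: "?D i (f + g) = ?D i f + ?D i g" if "f \<in> ?A" "g \<in> ?A" for f g
    using lfihd that unfolding lfihd_def by blast
  have "(\<Sum>m\<in>X. Poly_Mapping.single m (c m)) \<in> ?A \<and>
      ?D i (\<Sum>m\<in>X. Poly_Mapping.single m (c m))
      = (\<Sum>m\<in>X. Poly_Mapping.single (m + int i *s e) (coeff (symbol m) i * c m))"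
    if "finite X" "X \<subseteq> dual_monoid \<sigma>" for X and c :: "int ^ 'n \<Rightarrow> 'k"
    using that
  proof (induction X rule: finite_induct)
    case empty
    show ?case
      using zero add[OF zero zero] by simp
  next
    case (insert m X)
    then have "Poly_Mapping.single m (c m) \<in> ?A" "(\<Sum>m\<in>X. Poly_Mapping.single m (c m)) \<in> ?A"
      by (simp_all add: single_mem)
    with insert show ?case
      using subalgebra_semigroup_algebra[of \<sigma>, where ?'k = 'k]
      by (auto simp: add D_single subalgebra_def)
  qed
  from this[of "Poly_Mapping.keys f" "Poly_Mapping.lookup f"] show ?thesis
    using assms by (simp add: semigroup_algebra_def flip: poly_mapping_sum_single)
qed

end

section \<open>Nontrivial homogeneous actions come from Demazure roots\<close>

locale nontrivial_homogeneous_ga_action = homogeneous_ga_action +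
  assumes nontrivial: "lfihd_nontrivial (semigroup_algebra \<sigma>) (lfihd_of_action \<phi>)"
begin

lemma nonconstant_symbol:
  obtains m where "m \<in> dual_monoid \<sigma>" "0 < degree (symbol m)"
proof -
  obtain f i where f: "f \<in> semigroup_algebra \<sigma>" "0 < i" "lfihd_of_action \<phi> i f \<noteq> 0"
    using nontrivial unfolding lfihd_nontrivial_def lfihd_kernel_def by blast
  then obtain m where "m \<in> Poly_Mapping.keys f" "coeff (symbol m) i \<noteq> 0"
    unfolding lfihd_of_action_eq_sum[OF f(1)] by (metis (no_types, lifting) mult_zero_left single_zero sum.neutral)
  with f le_degree[of "symbol m" i] show thesis
    by (intro that[of m]) (auto simp: semigroup_algebra_def)
qed

text \<open>
  Starting from \<open>m\<close> with symbol of degree \<open>d > 0\<close>, the point \<open>u\<close> is the last one before \<open>m + d e\<close> on the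
  string \<open>m, m + e, \<dots>, m + d e\<close>. The coefficient of \<open>x\<^sup>d\<^sup>-\<^sup>1\<close> in the symbol of \<open>m\<close> may vanish in positive
  characteristic, so \<open>u\<close> cannot be reached by applying \<open>\<partial>\<^sup>d\<^sup>-\<^sup>1\<close>; it lies in the dual monoid because its
  multiple \<open>d u = m + (d - 1) (m + d e)\<close> does.
\<close>

lemma linear_symbol:
  obtains u c where "u \<in> dual_monoid \<sigma>" "u + e \<in> dual_monoid \<sigma>" "c \<noteq> 0"
    "symbol u = [:1, c:]" "symbol (u + e) = 1"
proof -
  obtain m where m: "m \<in> dual_monoid \<sigma>" "0 < degree (symbol m)"
    by (rule nonconstant_symbol)
  define d where "d = degree (symbol m)"
  define u where "u = m + int (d - 1) *s e"
  have ue: "u + e = m + int d *s e"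
    using m(2) by (simp add: u_def d_def vec_eq_iff algebra_simps)
  then have top: "u + e \<in> dual_monoid \<sigma>" "symbol (u + e) = 1"
    using symbol_top_shift[OF m(1)] by (simp_all add: d_def)
  have du: "int d *s u = m + int (d - 1) *s (u + e)"
    using m(2) by (simp add: u_def d_def vec_eq_iff algebra_simps)
  have "int d *s u \<in> dual_monoid \<sigma>"
    unfolding du by (rule dual_monoid_add[OF m(1) dual_monoid_scale[OF top(1)]])
  then have u: "u \<in> dual_monoid \<sigma>"
    using m(2) dual_monoid_saturated d_def by blast
  have "symbol u ^ d = symbol m"
    using symbol_add[OF m(1) dual_monoid_scale[OF top(1), of "d - 1"]]
    unfolding du[symmetric] symbol_scale[OF u] symbol_scale[OF top(1)] top(2) by simp
  then have "degree (symbol u ^ d) = d"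
    by (simp add: d_def)
  then have "d * degree (symbol u) = d"
    by (simp only: degree_power_eq[OF symbol_nonzero[OF u]])
  moreover have "d \<noteq> 0"
    using m(2) by (simp add: d_def)
  ultimately have deg: "degree (symbol u) = 1"
    using mult_eq_self_implies_10[of d "degree (symbol u)"] by presburger
  define c where "c = coeff (symbol u) 1"
  have "coeff (symbol u) i = coeff [:1, c:] i" for i
    using deg coeff_symbol_0[OF u] by (simp add: c_def coeff_pCons coeff_eq_0 split: nat.split)
  then have "symbol u = [:1, c:]"
    by (rule poly_eqI)
  moreover from this deg have "c \<noteq> 0"
    by auto
  ultimately show thesis
    using that u top by blast
qed

text \<open>
  With \<open>d\<close> the degree of the symbol of \<open>m\<close>, the point \<open>(m + d e) + d u = m + d (u + e)\<close> has symbol \<open>P\<^sub>u\<^sup>d\<close> by the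
  first decomposition and \<open>P\<^sub>m\<close> by the second.
\<close>

lemma symbol_eq_power:
  assumes u: "u \<in> dual_monoid \<sigma>" "u + e \<in> dual_monoid \<sigma>" "symbol (u + e) = 1"
    and m: "m \<in> dual_monoid \<sigma>"
  shows "symbol m = symbol u ^ degree (symbol m)"
proof -
  let ?d = "degree (symbol m)"
  have "(m + int ?d *s e) + int ?d *s u = m + int ?d *s (u + e)"
    by (simp add: vec_eq_iff algebra_simps)
  moreover have "symbol (m + int ?d *s e + int ?d *s u) = symbol u ^ ?d"
    using symbol_add[OF symbol_top_shift(1)[OF m] dual_monoid_scale[OF u(1)]]
    by (simp add: symbol_top_shift(2)[OF m] symbol_scale u)
  moreover have "symbol (m + int ?d *s (u + e)) = symbol m"
    using symbol_add[OF m dual_monoid_scale[OF u(2)]] symbol_scale[OF u(2)]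
    by (simp add: u(3) del: vector_add_ldistrib)
  ultimately show ?thesis
    by metis
qed

text \<open>
  Everything follows from the linear projection \<open>T v = v + \<langle>e, v\<rangle> \<rho>\<close>, which has kernel \<open>\<real> \<rho>\<close> and preserves
  \<open>\<sigma>\<close>. If \<open>a, b \<in> \<sigma>\<close> add up to a multiple of \<open>\<rho>\<close>, then \<open>T a + T b = 0\<close>, so \<open>T a = 0\<close> and \<open>a\<close> is a
  multiple of \<open>\<rho>\<close>: the ray is extremal. If \<open>e\<close> is negative on an extremal ray \<open>\<rho>'\<close>, then
  \<open>\<rho>' = T \<rho>' + k \<rho>\<close> with \<open>k > 0\<close> is a decomposition inside \<open>\<sigma>\<close>, so \<open>\<rho>\<close> lies on that ray and equals \<open>\<rho>'\<close>.
\<close>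

lemma distinguished_ray_if_degree:
  assumes deg: "\<And>m. m \<in> dual_monoid \<sigma> \<Longrightarrow> int (degree (symbol m)) = pairing m \<rho>"
    and e: "pairing e \<rho> = - 1"
  shows "is_distinguished_ray \<sigma> e \<rho>"
proof -
  let ?r = "lattice_vec \<rho>" and ?e = "lattice_vec e"
  have e': "?e \<bullet> ?r = - 1"
    by (simp add: inner_lattice_vec e)
  then have r0: "?r \<noteq> 0"
    by auto
  have r_mem: "?r \<in> \<sigma>"
    by (rule mem_if_dual_nonneg) (simp add: inner_lattice_vec flip: deg)
  \<comment> \<open>On lattice points the adjoint of \<open>T\<close> is \<open>m \<mapsto> m + \<langle>m, \<rho>\<rangle> e\<close>, the top shift.\<close>
  have T_mem: "v + (?e \<bullet> v) *\<^sub>R ?r \<in> \<sigma>" if v: "v \<in> \<sigma>" for v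
  proof (rule mem_if_dual_nonneg)
    fix m assume m: "m \<in> dual_monoid \<sigma>"
    have "lattice_vec m \<bullet> (v + (?e \<bullet> v) *\<^sub>R ?r)
        = lattice_vec (m + int (degree (symbol m)) *s e) \<bullet> v"
      by (simp add: inner_add_left inner_add_right inner_lattice_vec deg[OF m])
    also have "\<dots> \<ge> 0"
      using symbol_top_shift(1)[OF m] v unfolding dual_monoid_iff by blast
    finally show "0 \<le> lattice_vec m \<bullet> (v + (?e \<bullet> v) *\<^sub>R ?r)" .
  qed
  have summand: "a \<in> conic hull {?r}" if a: "a \<in> \<sigma>" and b: "b \<in> \<sigma>" and ab: "a + b = t *\<^sub>R ?r" for a b t
  proof -
    have "?e \<bullet> a + ?e \<bullet> b = - t"
      using arg_cong[OF ab, of "(\<bullet>) ?e"] by (simp add: inner_add_right e')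
    then have "(a + (?e \<bullet> a) *\<^sub>R ?r) + (b + (?e \<bullet> b) *\<^sub>R ?r) = 0"
      using ab by (simp add: algebra_simps flip: scaleR_add_left)
    then have "a + (?e \<bullet> a) *\<^sub>R ?r = 0"
      by (rule sum_eq_0_imp[OF T_mem[OF a] T_mem[OF b]])
    moreover have "?e \<bullet> a \<le> 0"
    proof (rule ccontr)
      assume pos: "\<not> ?e \<bullet> a \<le> 0"
      then have "(?e \<bullet> a) *\<^sub>R ?r \<in> \<sigma>"
        using r_mem by (intro scale_mem) auto
      moreover have "(?e \<bullet> a) *\<^sub>R ?r + a = 0"
        using \<open>a + _ = 0\<close> by (simp only: add.commute)
      ultimately have "(?e \<bullet> a) *\<^sub>R ?r = 0"
        using sum_eq_0_imp a by blast
      with pos r0 show False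
        by simp
    qed
    ultimately show ?thesis
      unfolding conic_hull_explicit
      by (auto intro!: exI[of _ "- (?e \<bullet> a)"] simp: eq_neg_iff_add_eq_0)
  qed
  have conic: "k *\<^sub>R y \<in> conic hull {?r}" if "y \<in> conic hull {?r}" "0 \<le> k" for k y
    using that conic_conic_hull[of "{?r}"] conic_def by blast
  have "conic hull {?r} face_of \<sigma>"
    unfolding face_of_def
  proof (intro conjI ballI impI)
    show "conic hull {?r} \<subseteq> \<sigma>"
      using r_mem scale_mem by (auto simp: conic_hull_explicit)
    show "convex (conic hull {?r})"
      by (simp add: convex_conic_hull)
  next
    fix a b x assume ab: "a \<in> \<sigma>" "b \<in> \<sigma>" and x: "x \<in> conic hull {?r}" "x \<in> open_segment a b"
    obtain t s where ts: "x = t *\<^sub>R ?r" "x = (1 - s) *\<^sub>R a + s *\<^sub>R b" "0 < s" "s < 1"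
      using x unfolding in_segment conic_hull_explicit by blast
    have mem: "(1 - s) *\<^sub>R a \<in> \<sigma>" "s *\<^sub>R b \<in> \<sigma>"
      using ab ts by (auto intro!: scale_mem)
    have "(1 - s) *\<^sub>R a \<in> conic hull {?r}" "s *\<^sub>R b \<in> conic hull {?r}"
      using summand[OF mem, of t] summand[OF mem(2,1), of t] ts by (simp_all add: add.commute)
    then have "inverse (1 - s) *\<^sub>R (1 - s) *\<^sub>R a \<in> conic hull {?r}"
      "inverse s *\<^sub>R s *\<^sub>R b \<in> conic hull {?r}"
      using ts by (auto intro!: conic simp del: scaleR_scaleR)
    then show "a \<in> conic hull {?r}" "b \<in> conic hull {?r}"
      using ts by auto
  qed
  moreover have "primitive \<rho>"
    unfolding primitive_def
  proof (intro allI impI)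
    fix d w assume "\<rho> = d *s w"
    then have "- 1 = d * pairing e w"
      using e by simp
    then show "is_unit d"
      by (metis dvd_triv_left dvd_minus_iff)
  qed
  ultimately have "\<rho> \<in> extremal_rays \<sigma>"
    by (simp add: extremal_rays_def)
  moreover have "0 \<le> pairing e \<rho>'" if \<rho>': "\<rho>' \<in> extremal_rays \<sigma> - {\<rho>}" for \<rho>'
  proof (rule ccontr)
    assume neg: "\<not> 0 \<le> pairing e \<rho>'"
    let ?r' = "lattice_vec \<rho>'"
    define k where "k = - pairing e \<rho>'"
    have k: "0 < k"
      using neg by (simp add: k_def)
    have face: "conic hull {?r'} face_of \<sigma>" and prim: "primitive \<rho>'"
      using \<rho>' by (auto simp: extremal_rays_def)
    have r'_mem: "?r' \<in> conic hull {?r'}"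
      by (simp add: hull_inc)
    then have "?r' \<in> \<sigma>"
      using face_of_imp_subset[OF face] by blast
    have T': "?r' - of_int k *\<^sub>R ?r \<in> \<sigma>"
      using T_mem[OF \<open>?r' \<in> \<sigma>\<close>] by (simp add: inner_lattice_vec k_def)
    \<comment> \<open>The factor \<open>2\<close> turns the sum \<open>\<rho>' = T \<rho>' + k \<rho>\<close> into a midpoint, as faces are defined by segments.\<close>
    define a where "a = 2 *\<^sub>R (?r' - of_int k *\<^sub>R ?r)"
    define b where "b = (2 * of_int k) *\<^sub>R ?r"
    have "a \<in> \<sigma>" "b \<in> \<sigma>"
      using T' r_mem k by (auto simp: a_def b_def intro!: scale_mem)
    moreover have mid: "?r' = (1/2) *\<^sub>R a + (1/2) *\<^sub>R b"
      by (simp add: a_def b_def algebra_simps)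
    ultimately have "b \<in> conic hull {?r'}"
    proof (cases "a = b")
      case True
      with mid have "?r' = b"
        by (simp flip: scaleR_add_left)
      with r'_mem show ?thesis
        by simp
    next
      case False
      then have "?r' \<in> open_segment a b"
        unfolding in_segment using mid by (auto intro!: exI[of _ "1/2"])
      then show ?thesis
        using face_ofD[OF face] \<open>a \<in> \<sigma>\<close> \<open>b \<in> \<sigma>\<close> r'_mem by blast
    qed
    then obtain s where s: "(2 * of_int k) *\<^sub>R ?r = s *\<^sub>R ?r'"
      unfolding b_def conic_hull_explicit by blast
    have "?e \<bullet> ?r' = - of_int k"
      by (simp add: inner_lattice_vec k_def)
    then have "s = 2"
      using arg_cong[OF s, of "(\<bullet>) ?e"] k e' by simp
    with s have "2 *\<^sub>R ?r' = 2 *\<^sub>R (of_int k *\<^sub>R ?r)"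
      by simp
    then have "?r' = lattice_vec (k *s \<rho>)"
      unfolding scaleR_cancel_left by simp
    then have "\<rho>' = k *s \<rho>"
      by (simp only: lattice_vec_eq_iff)
    moreover from this prim have "is_unit k"
      unfolding primitive_def by blast
    ultimately show False
      using \<rho>' k by simp
  qed
  ultimately show ?thesis
    by (simp add: is_distinguished_ray_def e)
qed

lemma eq_scale_demazure_lfihd:
  obtains c where "e \<in> demazure_roots \<sigma>" "c \<noteq> 0"
    "\<And>f i. f \<in> semigroup_algebra \<sigma> \<Longrightarrow> lfihd_of_action \<phi> i f
      = scale_lfihd (Poly_Mapping.single 0) c (demazure_lfihd \<sigma> e) i f"
proof -
  obtain u c where u: "u \<in> dual_monoid \<sigma>" "u + e \<in> dual_monoid \<sigma>" "symbol (u + e) = 1"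
    and c: "c \<noteq> 0" "symbol u = [:1, c:]"
    using linear_symbol by metis
  obtain \<rho> where \<rho>: "\<And>m. m \<in> dual_monoid \<sigma> \<Longrightarrow> int (degree (symbol m)) = pairing m \<rho>"
    using additive_is_pairing[of "\<lambda>m. degree (symbol m)"] degree_symbol_add by blast
  have "pairing e \<rho> = - 1"
    using \<rho>[OF u(1)] \<rho>[OF u(2)] u(3) c by simp
  then have ray: "is_distinguished_ray \<sigma> e \<rho>"
    using distinguished_ray_if_degree \<rho> by blast
  have coeff: "coeff (symbol m) i = c ^ i * of_nat (nat (pairing m \<rho>) choose i)"
    if m: "m \<in> dual_monoid \<sigma>" for m i
  proof -
    let ?d = "degree (symbol m)"
    have "coeff (symbol m) i = coeff ([:1, c:] ^ ?d) i"
      using symbol_eq_power[OF u m] c by simp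
    also have "\<dots> = c ^ i * of_nat (?d choose i)"
    proof (cases "i \<le> ?d")
      case True
      then show ?thesis
        by (simp add: coeff_linear_poly_power)
    next
      case False
      moreover have "degree ([:1, c:] ^ ?d) \<le> ?d"
        using degree_power_le[of "[:1, c:]" ?d] c by simp
      ultimately show ?thesis
        by (simp add: coeff_eq_0 binomial_eq_0)
    qed
    finally show ?thesis
      by (simp flip: \<rho>[OF m])
  qed
  have "lfihd_of_action \<phi> i f = scale_lfihd (Poly_Mapping.single 0) c (demazure_lfihd \<sigma> e) i f"
    if f: "f \<in> semigroup_algebra \<sigma>" for f i
    unfolding lfihd_of_action_eq_sum[OF f] scale_lfihd_def demazure_lfihd_def
      distinguished_ray_eq[OF ray] sum_distrib_left
    using f by (intro sum.cong) (auto simp: mult_single coeff mult.assoc semigroup_algebra_def)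
  moreover have "e \<in> demazure_roots \<sigma>"
    using ray by (auto simp: demazure_roots_def)
  ultimately show thesis
    using that c by blast
qed

end

lemma lfihd_cong:
  assumes "subalgebra \<iota> A" "\<And>i f. f \<in> A \<Longrightarrow> D i f = D' i f" "lfihd \<iota> A D"
  shows "lfihd \<iota> A D'"
proof -
  have A: "\<iota> c \<in> A" "f + g \<in> A" "f * g \<in> A" if "f \<in> A" "g \<in> A" for f g c
    using assms(1) that unfolding subalgebra_def by auto
  have D: "D i f \<in> A" if "f \<in> A" for i f
    using assms(3) that unfolding lfihd_def by blast
  have "lfihd \<iota> A D' \<longleftrightarrow> lfihd \<iota> A D"
    unfolding lfihd_def by (simp add: A D flip: assms(2))
  with assms(3) show ?thesis
    by blast
qed

theorem theorem3p5:
  fixes \<sigma> :: "(real ^ 'n::finite) set"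
    and \<phi> :: "((int ^ 'n) \<Rightarrow>\<^sub>0 'k::field) \<Rightarrow> ((int ^ 'n) \<Rightarrow>\<^sub>0 'k) poly"
  assumes "rational_cone \<sigma>" and "strongly_convex \<sigma>" and "\<sigma> \<noteq> {0}"
    and "ga_action (Poly_Mapping.single 0 :: 'k \<Rightarrow> _) (semigroup_algebra \<sigma>) \<phi>"
    and nontrivial: "lfihd_nontrivial (semigroup_algebra \<sigma>) (lfihd_of_action \<phi>)"
    and normalized: "\<exists>e. lfihd_homogeneous \<sigma> e (lfihd_of_action \<phi>)"
  shows "\<exists>e\<in>demazure_roots \<sigma>. \<exists>c :: 'k. c \<noteq> 0 \<and>
    (let D = scale_lfihd (Poly_Mapping.single 0) c (demazure_lfihd \<sigma> e) in
       lfihd (Poly_Mapping.single 0 :: 'k \<Rightarrow> _) (semigroup_algebra \<sigma>) D \<and>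
       lfihd_homogeneous \<sigma> e D \<and>
       (\<forall>f\<in>semigroup_algebra \<sigma>. \<phi> f = action_of_lfihd D f))"
proof -
  obtain e where e: "lfihd_homogeneous \<sigma> e (lfihd_of_action \<phi>)"
    using normalized by blast
  interpret nontrivial_homogeneous_ga_action \<sigma> \<phi> e
    using assms e by unfold_locales
  obtain c where root: "e \<in> demazure_roots \<sigma>" and "c \<noteq> 0"
    and eq: "\<And>f i. f \<in> semigroup_algebra \<sigma> \<Longrightarrow> lfihd_of_action \<phi> i f
      = scale_lfihd (Poly_Mapping.single 0) c (demazure_lfihd \<sigma> e) i f"
    using eq_scale_demazure_lfihd by blast
  define D where "D = scale_lfihd (Poly_Mapping.single 0) c (demazure_lfihd \<sigma> e)"
  note eq = eq[folded D_def]
  have "lfihd (Poly_Mapping.single 0 :: 'k \<Rightarrow> _) (semigroup_algebra \<sigma>) D"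
    by (rule lfihd_cong[OF subalgebra_semigroup_algebra eq lfihd])
  moreover from this have "\<forall>f\<in>semigroup_algebra \<sigma>. \<phi> f = action_of_lfihd D f"
    by (auto intro!: poly_eqI simp: coeff_action_of_lfihd lfihd_of_action_def simp flip: eq)
  moreover have "lfihd_homogeneous \<sigma> e D"
    using e eq unfolding lfihd_homogeneous_def homogeneous_piece_def by fastforce
  ultimately show ?thesis
    using root \<open>c \<noteq> 0\<close> unfolding D_def Let_def by blast
qed

end
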